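(* For each $i\in\{1,\ldots,n\}$, the sum $\sum_{j=0}^n A(n,i,j)$ equals the number of excedant functions $f:\{1,2,\ldots,2n-1\}\to\{1,2,\ldots,2n-1\}$ satisfying: (1) $f(2k)\le 2n-2$ for $k=1,\ldots,n-1$; (2) $f(\{1,\ldots,2n-1\})=\{2,4,\ldots,2n-2\}\cup\{2n-1\}$; (3) $|f^{-1}(\{2n-1\})|=i$.
   Context: A function $f$ is excedant if $f(i)\ge i$ for all $i$. A tournament on $\{1,\ldots,n\}$ has, for each pair $i\ne j$, exactly one of the arcs $i\to j$, $j\to i$; an arc $i\to j$ is an ascent if $i<j$, a descent if $i>j$; alternation acyclic means no directed cycle along which ascents and descents alternate. A parent function is $p:\{1,\ldots,n\}\to\{2,\ldots,n\}\cup\{\infty\}$ with $p(i)>i$. For a permutation $\pi$, $T(\pi,p)$ has, for $u<v$, $u\to v$ if $p(u)\ne\infty$ and $\pi^{-1}(v)\ge\pi^{-1}(p(u))$, else $v\to u$. Right-alternating walk order $\preceq$: $u\preceq v$ if $u=v$ or there is a directed walk from $u$ to $v$ of positive even length alternating descent, ascent, …, ending with an ascent. For alternation acyclic $T$, the largest maximal order $\lambda$ is the permutation with $\lambda(k)$ the largest maximal element of $\{\lambda(1),\ldots,\lambda(k)\}$ under the restriction of $\preceq$ for every $k$; the largest maximal representation is $(\lambda,p)$ with $p$ the unique parent function with $T(\lambda,p)=T$. $T$ has type $(n,i,j)$ if $|p^{-1}(\infty)|=i$ and $|p(\{1,\ldots,n\})|=j+1$ (range including $\infty$); $A(n,i,j)$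 is the number of alternation acyclic tournaments on $\{1,\ldots,n\}$ of type $(n,i,j)$. *)

theory Defs
  imports
    "HOL-Library.FuncSet"
    "HOL-Library.Extended_Nat"
    "HOL-Combinatorics.Permutations"
begin

text \<open>A tournament is represented by its set of arcs; \<open>(u, v) \<in> T\<close> means \<open>u \<rightarrow> v\<close>.\<close>

definition tournament_on :: "nat \<Rightarrow> (nat \<times> nat) set \<Rightarrow> bool" where
  "tournament_on n T \<longleftrightarrow>
     T \<subseteq> {1..n} \<times> {1..n} \<and> irrefl T \<and>
     (\<forall>i\<in>{1..n}. \<forall>j\<in>{1..n}. i \<noteq> j \<longrightarrow> ((i, j) \<in> T) \<noteq> ((j, i) \<in> T))"

definition ascent :: "(nat \<times> nat) set \<Rightarrow> nat \<Rightarrow> nat \<Rightarrow> bool" where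
  "ascent T u v \<longleftrightarrow> (u, v) \<in> T \<and> u < v"

definition descent :: "(nat \<times> nat) set \<Rightarrow> nat \<Rightarrow> nat \<Rightarrow> bool" where
  "descent T u v \<longleftrightarrow> (u, v) \<in> T \<and> u > v"

definition directed_cycle :: "(nat \<times> nat) set \<Rightarrow> nat list \<Rightarrow> bool" where
  "directed_cycle T c \<longleftrightarrow>
     c \<noteq> [] \<and> distinct c \<and>
     (\<forall>i<length c. (c ! i, c ! (Suc i mod length c)) \<in> T)"

text \<open>Alternation is cyclic: the last arc of the cycle is followed by its first one.
  In particular an alternating cycle automatically has even length.\<close>

definition alternating_cycle :: "(nat \<times> nat) set \<Rightarrow> nat list \<Rightarrow> bool" where
  "alternating_cycle T c \<longleftrightarrow>
     directed_cycle T c \<and>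
     (let l = length c in
      \<forall>i<l. ascent T (c ! i) (c ! (Suc i mod l)) \<longleftrightarrow>
            descent T (c ! (Suc i mod l)) (c ! (Suc (Suc i) mod l)))"

definition alternation_acyclic :: "(nat \<times> nat) set \<Rightarrow> bool" where
  "alternation_acyclic T \<longleftrightarrow> (\<nexists>c. alternating_cycle T c)"

text \<open>The walk is given by its list of vertices, so its number of arcs is \<open>length w - 1\<close>.
  Vertices may repeat.\<close>

definition right_alternating_walk ::
    "(nat \<times> nat) set \<Rightarrow> nat list \<Rightarrow> bool" where
  "right_alternating_walk T w \<longleftrightarrow>
     length w > 1 \<and> even (length w - 1) \<and>
     (\<forall>i<length w - 1. if even i then descent T (w ! i) (w ! Suc i)
                        else ascent T (w ! i) (w ! Suc i))"

definition raw_le :: "(nat \<times> nat) set \<Rightarrow> nat \<Rightarrow> nat \<Rightarrow> bool" where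
  "raw_le T u v \<longleftrightarrow>
     u = v \<or> (\<exists>w. right_alternating_walk T w \<and> hd w = u \<and> last w = v)"

definition raw_maximal :: "(nat \<times> nat) set \<Rightarrow> nat set \<Rightarrow> nat set" where
  "raw_maximal T S = {x \<in> S. \<forall>y\<in>S. raw_le T x y \<longrightarrow> y = x}"

text \<open>A permutation \<open>\<pi>\<close> stands for the word \<open>\<pi>(1) \<dots> \<pi>(n)\<close>. The order \<open>\<preceq>\<close> selects the maximal
  elements of a prefix; the largest of them is taken in the usual order of the integers.\<close>

definition largest_maximal_order ::
    "nat \<Rightarrow> (nat \<times> nat) set \<Rightarrow> (nat \<Rightarrow> nat) \<Rightarrow> bool" where
  "largest_maximal_order n T \<pi> \<longleftrightarrow>
     \<pi> permutes {1..n} \<and>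
     (\<forall>k\<in>{1..n}. \<pi> k \<in> raw_maximal T (\<pi> ` {1..k}) \<and>
                  (\<forall>x\<in>raw_maximal T (\<pi> ` {1..k}). x \<le> \<pi> k))"

definition parent_function :: "nat \<Rightarrow> (nat \<Rightarrow> enat) \<Rightarrow> bool" where
  "parent_function n p \<longleftrightarrow>
     p \<in> {1..n} \<rightarrow>\<^sub>E (enat ` {2..n} \<union> {\<infinity>}) \<and> (\<forall>i\<in>{1..n}. p i > enat i)"

definition parent_arc :: "(nat \<Rightarrow> nat) \<Rightarrow> (nat \<Rightarrow> enat) \<Rightarrow> nat \<Rightarrow> nat \<Rightarrow> bool" where
  "parent_arc \<pi> p u v \<longleftrightarrow> p u \<noteq> \<infinity> \<and> inv \<pi> v \<ge> inv \<pi> (the_enat (p u))"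

definition tournament_of ::
    "nat \<Rightarrow> (nat \<Rightarrow> nat) \<Rightarrow> (nat \<Rightarrow> enat) \<Rightarrow> (nat \<times> nat) set" where
  "tournament_of n \<pi> p =
     {(u, v). u \<in> {1..n} \<and> v \<in> {1..n} \<and> u < v \<and> parent_arc \<pi> p u v} \<union>
     {(v, u). u \<in> {1..n} \<and> v \<in> {1..n} \<and> u < v \<and> \<not> parent_arc \<pi> p u v}"

definition largest_maximal_representation ::
    "nat \<Rightarrow> (nat \<times> nat) set \<Rightarrow> (nat \<Rightarrow> nat) \<Rightarrow> (nat \<Rightarrow> enat) \<Rightarrow> bool" where
  "largest_maximal_representation n T \<pi> p \<longleftrightarrow>
     largest_maximal_order n T \<pi> \<and> parent_function n p \<and> tournament_of n \<pi> p = T"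

text \<open>Every alternation acyclic tournament has exactly one largest maximal representation,
  so the existential quantifier only names it.\<close>

definition has_type :: "nat \<Rightarrow> (nat \<times> nat) set \<Rightarrow> nat \<Rightarrow> nat \<Rightarrow> bool" where
  "has_type n T i j \<longleftrightarrow>
     (\<exists>\<pi> p. largest_maximal_representation n T \<pi> p \<and>
        card {u \<in> {1..n}. p u = \<infinity>} = i \<and> card (p ` {1..n}) = j + 1)"

definition num_alt_acyclic :: "nat \<Rightarrow> nat \<Rightarrow> nat \<Rightarrow> nat" where
  "num_alt_acyclic n i j =
     card {T. tournament_on n T \<and> alternation_acyclic T \<and> has_type n T i j}"

definition excedant_functions :: "nat \<Rightarrow> (nat \<Rightarrow> nat) set" where
  "excedant_functions m = {f \<in> {1..m} \<rightarrow>\<^sub>E {1..m}. \<forall>i\<in>{1..m}. f i \<ge> i}"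

end

theory Submission
  imports Defs "HOL-Combinatorics.Multiset_Permutations"
begin

text \<open>
  The word \<open>\<lambda>\<close> of the largest maximal representation \<open>(\<lambda>, p)\<close> is characterised by the
  condition that each of its descent bottoms lies in the set \<open>J\<close> of finite values of \<open>p\<close>.
  Inserting the letters in increasing order, there are \<open>\<Prod>\<^sub>v (1 + |J \<inter> {1..<v}|)\<close> such words.
  An excedant function \<open>f\<close> as in the theorem splits into its values at odd arguments, which form
  a parent function \<open>p\<close>, and its values at even arguments, which form an excedant function on
  \<open>{1..n - 1}\<close> whose image must contain everything that \<open>p\<close> misses. The number of the latter is
  the same product, so both sides agree already for each fixed \<open>p\<close>.
\<close>

subsection \<open>Largest maximal representations\<close>

definition descent_bottoms_in :: "nat \<Rightarrow> nat set \<Rightarrow> (nat \<Rightarrow> nat) \<Rightarrow> bool" where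
  "descent_bottoms_in n J \<pi> \<longleftrightarrow> (\<forall>k\<in>{1..<n}. \<pi> (Suc k) < \<pi> k \<longrightarrow> \<pi> (Suc k) \<in> J)"

definition finite_parents :: "nat \<Rightarrow> (nat \<Rightarrow> enat) \<Rightarrow> nat set" where
  "finite_parents n p = {b. enat b \<in> p ` {1..n}}"

section \<open>Walks and cycles in the tournament of a word and a parent function\<close>

lemma tournament_on_tournament_of: "tournament_on n (tournament_of n \<pi> p)"
  unfolding tournament_on_def tournament_of_def irrefl_def
  by (auto simp: not_less)

lemma ascent_tournament_of:
  "ascent (tournament_of n \<pi> p) u v \<longleftrightarrow>
     u \<in> {1..n} \<and> v \<in> {1..n} \<and> u < v \<and> parent_arc \<pi> p u v"
  unfolding ascent_def tournament_of_def by auto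

lemma descent_tournament_of:
  "descent (tournament_of n \<pi> p) v u \<longleftrightarrow>
     u \<in> {1..n} \<and> v \<in> {1..n} \<and> u < v \<and> \<not> parent_arc \<pi> p u v"
  unfolding descent_def tournament_of_def by auto

text \<open>Both arcs are governed by the position of \<open>p x\<close>: the descent into
  \<open>x\<close> puts \<open>u\<close> before it, the ascent out of \<open>x\<close> puts
  \<open>v\<close> at or after it.\<close>

lemma descent_ascent_inv_less:
  assumes "descent (tournament_of n \<pi> p) u x" "ascent (tournament_of n \<pi> p) x v"
  shows "inv \<pi> u < inv \<pi> v"
  using assms unfolding ascent_tournament_of descent_tournament_of parent_arc_def by auto

text \<open>Every descent-ascent pair moves at least one position to the right. The count
  \<open>m\<close> is kept because it later forces a walk between neighbouring letters to be a
  single such pair.\<close>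

lemma walk_inv_mono:
  assumes "right_alternating_walk (tournament_of n \<pi> p) w" "2 * m < length w"
  shows "inv \<pi> (w ! 0) + m \<le> inv \<pi> (w ! (2 * m))"
  using assms(2)
proof (induction m)
  case (Suc m)
  have "descent (tournament_of n \<pi> p) (w ! (2 * m)) (w ! Suc (2 * m))"
    "ascent (tournament_of n \<pi> p) (w ! Suc (2 * m)) (w ! Suc (Suc (2 * m)))"
    using assms(1) Suc.prems unfolding right_alternating_walk_def
    by (metis (no_types, lifting) Suc_lessD add_2_eq_Suc even_Suc even_mult_iff even_numeral
        less_diff_conv mult_Suc_right Suc_eq_plus1)+
  from descent_ascent_inv_less[OF this] Suc show ?case by simp
qed simp

lemma raw_leE:
  assumes "raw_le (tournament_of n \<pi> p) u v" "u \<noteq> v"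
  obtains w m where "right_alternating_walk (tournament_of n \<pi> p) w" "length w = Suc (2 * m)"
    "m > 0" "w ! 0 = u" "w ! (2 * m) = v" "inv \<pi> u + m \<le> inv \<pi> v"
proof -
  obtain w where w: "right_alternating_walk (tournament_of n \<pi> p) w" "hd w = u" "last w = v"
    using assms unfolding raw_le_def by auto
  then have l: "length w > 1" "even (length w - 1)"
    unfolding right_alternating_walk_def by auto
  then obtain m where m: "length w - 1 = 2 * m" by (elim evenE)
  then have lw: "length w = Suc (2 * m)" "m > 0" using l by auto
  have w0: "w ! 0 = u" "w ! (2 * m) = v"
    using w l(1) hd_conv_nth[of w] last_conv_nth[of w] unfolding m[symmetric] by force+
  from that[OF w(1) lw w0] walk_inv_mono[OF w(1), of m] lw w0 show thesis by simp
qed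

lemma raw_le_inv_less:
  assumes "raw_le (tournament_of n \<pi> p) u v" "u \<noteq> v"
  shows "inv \<pi> u < inv \<pi> v"
  using assms by (elim raw_leE) auto

lemma raw_le_descent_ascent:
  assumes "descent T u x" "ascent T x v"
  shows "raw_le T u v"
  unfolding raw_le_def right_alternating_walk_def
  using assms by (intro disjI2 exI[of _ "[u, x, v]"]) (auto simp: less_Suc_eq)

text \<open>Along an alternating cycle the position in \<open>\<pi>\<close> would increase strictly from each peak
  to the next.\<close>

lemma alternation_acyclic_tournament_of:
  "alternation_acyclic (tournament_of n \<pi> p)"
  unfolding alternation_acyclic_def
proof
  let ?T = "tournament_of n \<pi> p"
  assume "\<exists>c. alternating_cycle ?T c"
  then obtain c where c: "alternating_cycle ?T c" by blast
  define l where "l = length c"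
  define a where "a i = ascent ?T (c ! i) (c ! (Suc i mod l))" for i
  define d where "d i = descent ?T (c ! i) (c ! (Suc i mod l))" for i
  have l: "l > 0" and arc: "\<And>i. i < l \<Longrightarrow> (c ! i, c ! (Suc i mod l)) \<in> ?T"
    and alt: "\<And>i. i < l \<Longrightarrow> a i \<longleftrightarrow> d (Suc i mod l)"
    using c unfolding alternating_cycle_def directed_cycle_def l_def a_def d_def Let_def
    by (auto simp: mod_Suc_eq)
  have ad: "a i \<longleftrightarrow> \<not> d i" if "i < l" for i
    using arc[OF that] tournament_on_tournament_of[of n \<pi> p]
    unfolding a_def d_def ascent_def descent_def tournament_on_def irrefl_def
    by (metis linorder_neqE_nat order.asym)
  let ?D = "{i. i < l \<and> d i}"
  have "?D \<noteq> {}"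
  proof (cases "d 0")
    case True
    then show ?thesis using l by blast
  next
    case False
    then have "d (Suc 0 mod l)" using l alt[of 0] ad[of 0] by simp
    then show ?thesis using mod_less_divisor[OF l, of "Suc 0"] by blast
  qed
  moreover have fin: "finite ?D" by simp
  ultimately obtain i where i: "i \<in> ?D"
    and "Max ((\<lambda>i. inv \<pi> (c ! i)) ` ?D) = inv \<pi> (c ! i)"
    using obtains_MAX[of ?D "\<lambda>i. inv \<pi> (c ! i)"] by blast
  then have imax: "inv \<pi> (c ! k) \<le> inv \<pi> (c ! i)" if "k \<in> ?D" for k
    using Max_ge[OF finite_imageI[OF fin] imageI[OF that]] by metis
  define j where "j = Suc i mod l"
  define k where "k = Suc j mod l"
  have jk: "j < l" "k < l" using l by (auto simp: j_def k_def)
  \<comment> \<open>The arc out of \<open>i\<close> is a descent, so alternation makes the arc out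
    of \<open>j\<close> an ascent and the one out of \<open>k\<close> again a descent. Thus
    \<open>k\<close> is a peak further right than \<open>i\<close>.\<close>
  have "a j" using alt[of i] ad i jk unfolding j_def by auto
  then have "d k" using alt jk unfolding k_def by auto
  with jk imax have "inv \<pi> (c ! k) \<le> inv \<pi> (c ! i)" by auto
  moreover have "inv \<pi> (c ! i) < inv \<pi> (c ! k)"
    using \<open>a j\<close> i descent_ascent_inv_less unfolding a_def d_def j_def k_def by auto
  ultimately show False by simp
qed

text \<open>As \<preceq> only moves to the right in the word, the last letter of a prefix is always
  maximal there; only its being the largest is at stake. A larger letter just before it must then be
  dominated by it, which happens through an \<open>x\<close> whose parent is that last
  letter.\<close>

lemma largest_maximal_order_iff:
  assumes \<pi>: "\<pi> permutes {1..n}" and p: "parent_function n p"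
  shows "largest_maximal_order n (tournament_of n \<pi> p) \<pi> \<longleftrightarrow>
    descent_bottoms_in n (finite_parents n p) \<pi>"
proof
  let ?T = "tournament_of n \<pi> p"
  have inv: "inv \<pi> (\<pi> k) = k" for k using \<pi> by (simp add: permutes_inverses)
  have in_range: "\<pi> k \<in> {1..n}" if "k \<in> {1..n}" for k using permutes_in_image[OF \<pi>, of k] that by blast
  {
    assume lmo: "largest_maximal_order n ?T \<pi>"
    show "descent_bottoms_in n (finite_parents n p) \<pi>"
      unfolding descent_bottoms_in_def
    proof (intro ballI impI)
      fix k assume k: "k \<in> {1..<n}" and desc: "\<pi> (Suc k) < \<pi> k"
      have "\<forall>x\<in>raw_maximal ?T (\<pi> ` {1..Suc k}). x \<le> \<pi> (Suc k)"
        using lmo k unfolding largest_maximal_order_def by auto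
      with desc have "\<pi> k \<notin> raw_maximal ?T (\<pi> ` {1..Suc k})" by auto
      then obtain r where r: "r \<in> {1..Suc k}" and rl: "raw_le ?T (\<pi> k) (\<pi> r)" "\<pi> k \<noteq> \<pi> r"
        using k unfolding raw_maximal_def by auto
      from rl obtain w m where w: "right_alternating_walk ?T w" "length w = Suc (2 * m)"
        "m > 0" "w ! 0 = \<pi> k" "w ! (2 * m) = \<pi> r" "k + m \<le> r"
        using raw_leE[of n \<pi> p "\<pi> k" "\<pi> r"] unfolding inv by metis
      \<comment> \<open>\<open>r \<le> Suc k\<close> and \<open>k + m \<le> r\<close> leave room for
        one descent-ascent pair only.\<close>
      with r have m: "m = 1" "r = Suc k" by auto
      define x where "x = w ! 1"
      have "descent ?T (\<pi> k) x" "ascent ?T x (\<pi> (Suc k))"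
        using w m unfolding right_alternating_walk_def x_def
        by (auto dest: spec[of _ 0] spec[of _ 1] simp: numeral_2_eq_2)
      then have x: "x \<in> {1..n}" "\<not> parent_arc \<pi> p x (\<pi> k)" "parent_arc \<pi> p x (\<pi> (Suc k))"
        unfolding ascent_tournament_of descent_tournament_of by auto
      then obtain b where b: "p x = enat b" unfolding parent_arc_def by auto
      \<comment> \<open>The descent from \<open>\<pi> k\<close> into \<open>x\<close> places
        \<open>b\<close> after position \<open>k\<close>, the ascent to \<open>\<pi> (Suc k)\<close>
        not after position \<open>Suc k\<close>.\<close>
      then have "inv \<pi> b = Suc k" using x unfolding parent_arc_def inv by auto
      then have "b = \<pi> (Suc k)" using permutes_inverses(1)[OF \<pi>, of b] by simp
      with b x(1) show "\<pi> (Suc k) \<in> finite_parents n p"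
        unfolding finite_parents_def by (metis imageI mem_Collect_eq)
    qed
  next
    assume db: "descent_bottoms_in n (finite_parents n p) \<pi>"
    show "largest_maximal_order n ?T \<pi>"
      unfolding largest_maximal_order_def
    proof (intro conjI \<pi> ballI)
      fix k assume k: "k \<in> {1..n}"
      show "\<pi> k \<in> raw_maximal ?T (\<pi> ` {1..k})"
        unfolding raw_maximal_def using k raw_le_inv_less[of n \<pi> p "\<pi> k"] inv by fastforce
      fix x assume x: "x \<in> raw_maximal ?T (\<pi> ` {1..k})"
      then obtain m where m: "m \<in> {1..k}" "x = \<pi> m" unfolding raw_maximal_def by auto
      show "x \<le> \<pi> k"
      proof (rule ccontr)
        assume "\<not> x \<le> \<pi> k"
        \<comment> \<open>The first position from \<open>m\<close> on whose letter is below
          \<open>x\<close>. The letter before it is at least \<open>x\<close>, so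
          \<open>\<pi> t\<close> is a descent bottom and hence a parent.\<close>
        define t where "t = (LEAST t. m \<le> t \<and> \<pi> t < x)"
        have ex: "m \<le> k \<and> \<pi> k < x" using m \<open>\<not> x \<le> \<pi> k\<close> by auto
        have t: "m \<le> t" "\<pi> t < x" "t \<le> k"
          using LeastI[of "\<lambda>t. m \<le> t \<and> \<pi> t < x", OF ex] Least_le[of "\<lambda>t. m \<le> t \<and> \<pi> t < x", OF ex]
          unfolding t_def by auto
        have mt: "m < t" using t m by (metis le_neq_implies_less less_irrefl)
        then obtain l where l: "t = Suc l" by (cases t) auto
        have lx: "\<pi> l \<ge> x"
          using not_less_Least[of l "\<lambda>t. m \<le> t \<and> \<pi> t < x"] mt l unfolding t_def[symmetric] by auto
        have "\<pi> t \<in> finite_parents n p"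
          using db lx t l m mt k unfolding descent_bottoms_in_def by auto
        then obtain y where y: "y \<in> {1..n}" "p y = enat (\<pi> t)" unfolding finite_parents_def by auto
        have yt: "y < \<pi> t" using p y unfolding parent_function_def by fastforce
        \<comment> \<open>\<open>x\<close> stands before \<open>\<pi> t = p y\<close> in the word
          and exceeds \<open>y\<close>, so the arc between them points down to
          \<open>y\<close>.\<close>
        have "descent ?T x y"
          unfolding descent_tournament_of using y yt t m mt k in_range[of m]
          by (auto simp: parent_arc_def inv)
        moreover have "ascent ?T y (\<pi> t)"
          unfolding ascent_tournament_of using y yt t m mt k in_range[of t]
          by (auto simp: parent_arc_def inv)
        ultimately have "raw_le ?T x (\<pi> t)" by (rule raw_le_descent_ascent)
        then have "\<pi> t = x" using x t m mt unfolding raw_maximal_def by auto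
        with t show False by simp
      qed
    qed
  }
qed

section \<open>Uniqueness of the representation\<close>

text \<open>The word is recovered from its end: the set of letters of a prefix determines the last
  one as its largest maximal element, and removing that letter leaves the next shorter
  prefix.\<close>

lemma largest_maximal_order_unique:
  assumes "largest_maximal_order n T \<pi>" "largest_maximal_order n T \<rho>"
  shows "\<pi> = \<rho>"
proof -
  have perm: "\<pi> permutes {1..n}" "\<rho> permutes {1..n}"
    using assms unfolding largest_maximal_order_def by auto
  have top: "\<pi> k = \<rho> k" if "\<pi> ` {1..k} = \<rho> ` {1..k}" "k \<in> {1..n}" for k
    using assms that unfolding largest_maximal_order_def by (metis le_antisym)
  have img: "\<pi> ` {1..k} = \<rho> ` {1..k}" if "k \<le> n" for k
    using that
  proof (induction k rule: inc_induct)
    case base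
    show ?case using perm by (simp add: permutes_image)
  next
    case (step k)
    have *: "\<sigma> ` {1..k} = \<sigma> ` {1..Suc k} - {\<sigma> (Suc k)}" if "\<sigma> permutes {1..n}" for \<sigma>
      using permutes_inj[OF that] by (auto simp: inj_eq atLeastAtMostSuc_conv)
    show ?case using *[OF perm(1)] *[OF perm(2)] step top[of "Suc k"] by simp
  qed
  show ?thesis
  proof
    fix k show "\<pi> k = \<rho> k"
      using top[of k] img[of k] perm by (cases "k \<in> {1..n}") (auto simp: permutes_def)
  qed
qed

text \<open>Among the ascents out of \<open>u\<close>, the one to \<open>p u\<close> has the
  leftmost target in the word, and \<open>p u = \<infinity>\<close> means that there are none; so
  the arcs determine \<open>p\<close>.\<close>

lemma tournament_of_parent_unique:
  assumes \<pi>: "\<pi> permutes {1..n}" and p: "parent_function n p" and q: "parent_function n q"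
    and eq: "tournament_of n \<pi> p = tournament_of n \<pi> q"
  shows "p = q"
proof
  have arc: "parent_arc \<pi> p u v \<longleftrightarrow> parent_arc \<pi> q u v"
    if "u \<in> {1..n}" "v \<in> {1..n}" "u < v" for u v
    using ascent_tournament_of[of n \<pi> p u v] ascent_tournament_of[of n \<pi> q u v] eq that by auto
  have range: "b \<in> {1..n} \<and> u < b"
    if "parent_function n r" "u \<in> {1..n}" "r u = enat b" for r u b
    using that unfolding parent_function_def PiE_def Pi_def by fastforce
  fix u
  show "p u = q u"
  proof (cases "u \<in> {1..n}")
    case False
    then show ?thesis using p q unfolding parent_function_def by (metis PiE_arb)
  next
    case u: True
    have self: "parent_arc \<pi> r u b" if "r u = enat b" for r b
      using that unfolding parent_arc_def by auto
    show ?thesis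
    proof (cases "p u")
      case a: (enat a)
      then have "parent_arc \<pi> q u a" using arc[OF u] range[OF p u a] self[of p a] by auto
      then obtain b where b: "q u = enat b" and "inv \<pi> b \<le> inv \<pi> a" unfolding parent_arc_def by auto
      moreover have "parent_arc \<pi> p u b" using arc[OF u] range[OF q u b] self[of q b] b by auto
      ultimately have "inv \<pi> a = inv \<pi> b" using a unfolding parent_arc_def by auto
      then show ?thesis using a b \<pi> by (metis permutes_inverses(1))
    next
      case infinity
      then have "q u \<noteq> enat b" for b
        using arc[OF u, of b] range[OF q u, of b] self[of q b] unfolding parent_arc_def by auto
      then show ?thesis using infinity by (cases "q u") auto
    qed
  qed
qed

lemma largest_maximal_representation_iff:
  "largest_maximal_representation n T \<pi> p \<longleftrightarrow>
     \<pi> permutes {1..n} \<and> parent_function n p \<and>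
     descent_bottoms_in n (finite_parents n p) \<pi> \<and> T = tournament_of n \<pi> p"
  using largest_maximal_order_iff[of \<pi> n p]
  unfolding largest_maximal_representation_def
  by (metis largest_maximal_order_def)

lemma largest_maximal_representation_unique:
  assumes "largest_maximal_representation n T \<pi> p" "largest_maximal_representation n T \<rho> q"
  shows "\<pi> = \<rho>" "p = q"
proof -
  show "\<pi> = \<rho>"
    using assms largest_maximal_order_unique unfolding largest_maximal_representation_def by blast
  with assms show "p = q"
    using tournament_of_parent_unique unfolding largest_maximal_representation_iff by metis
qed

section \<open>Counting pairs instead of tournaments\<close>

text \<open>The parent function comes first so that the admissible words form the fibre over it;
  \<open>j\<close> is absent because it will be summed over.\<close>

definition representations :: "nat \<Rightarrow> nat \<Rightarrow> ((nat \<Rightarrow> enat) \<times> (nat \<Rightarrow> nat)) set" where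
  "representations n i =
     (SIGMA p:{p. parent_function n p \<and> card {u \<in> {1..n}. p u = \<infinity>} = i}.
        {\<pi>. \<pi> permutes {1..n} \<and> descent_bottoms_in n (finite_parents n p) \<pi>})"

text \<open>Having a type provides a pair by definition, every admissible pair yields an alternation
  acyclic tournament, and uniqueness recovers the pair from it.\<close>

lemma num_alt_acyclic_eq:
  "num_alt_acyclic n i j = card {(p, \<pi>) \<in> representations n i. card (p ` {1..n}) = j + 1}"
proof -
  let ?R = "{(p, \<pi>) \<in> representations n i. card (p ` {1..n}) = j + 1}"
  have "bij_betw (\<lambda>(p, \<pi>). tournament_of n \<pi> p) ?R
    {T. tournament_on n T \<and> alternation_acyclic T \<and> has_type n T i j}"
    unfolding bij_betw_def
  proof
    show "inj_on (\<lambda>(p, \<pi>). tournament_of n \<pi> p) ?R"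
    proof (rule inj_onI, clarsimp)
      fix p \<pi> q \<rho>
      assume "(p, \<pi>) \<in> representations n i" "(q, \<rho>) \<in> representations n i"
        "tournament_of n \<pi> p = tournament_of n \<rho> q"
      then show "p = q \<and> \<pi> = \<rho>"
        using largest_maximal_representation_unique[of n "tournament_of n \<pi> p" \<pi> p \<rho> q]
        unfolding largest_maximal_representation_iff representations_def by auto
    qed
    show "(\<lambda>(p, \<pi>). tournament_of n \<pi> p) ` ?R =
      {T. tournament_on n T \<and> alternation_acyclic T \<and> has_type n T i j}"
      unfolding has_type_def largest_maximal_representation_iff representations_def
      by (auto simp: tournament_on_tournament_of alternation_acyclic_tournament_of image_iff)
  qed
  from bij_betw_same_card[OF this] show ?thesis unfolding num_alt_acyclic_def by simp
qed

lemma finite_parent_functions: "finite {p. parent_function n p}"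
proof -
  have "finite ({1..n} \<rightarrow>\<^sub>E (enat ` {2..n} \<union> {\<infinity>}))" by (intro finite_PiE) auto
  then show ?thesis by (rule finite_subset[rotated]) (auto simp: parent_function_def)
qed

lemma finite_representations: "finite (representations n i)"
  unfolding representations_def
  by (intro finite_SigmaI finite_subset[OF _ finite_parent_functions[of n]]
      finite_subset[OF _ finite_permutations[of "{1..n}"]]) auto

lemma sum_num_alt_acyclic:
  assumes "n \<ge> 1"
  shows "(\<Sum>j=0..n. num_alt_acyclic n i j) = card (representations n i)"
proof -
  let ?R = "\<lambda>j. {(p, \<pi>) \<in> representations n i. card (p ` {1..n}) = j + 1}"
  have "(\<Sum>j=0..n. num_alt_acyclic n i j) = (\<Sum>j\<in>{0..n}. card (?R j))"
    by (simp add: num_alt_acyclic_eq)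
  also have "\<dots> = card (\<Union>j\<in>{0..n}. ?R j)"
    by (rule card_UN_disjoint[symmetric])
      (auto intro: finite_subset[OF _ finite_representations[of n i]])
  also have "(\<Union>j\<in>{0..n}. ?R j) = representations n i"
  proof -
    \<comment> \<open>For \<open>n \<ge> 1\<close> the range of \<open>p\<close> has between 1 and
      \<open>n\<close> elements, so the truncated subtraction is exact and each pair is met by some
      \<open>j\<close>.\<close>
    have "card (p ` {1..n}) - 1 \<in> {0..n} \<and> card (p ` {1..n}) = card (p ` {1..n}) - 1 + 1" for p :: "nat \<Rightarrow> enat"
      using card_image_le[of "{1..n}" p] assms by (auto simp: Suc_le_eq card_gt_0_iff)
    then show ?thesis by blast
  qed
  finally show ?thesis .
qed

subsection \<open>Permutations with prescribed descent bottoms\<close>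

text \<open>With lists in place of functions, inserting a letter is a cut \<open>ys @ zs\<close>,
  without shifting positions.\<close>

definition descent_words :: "nat \<Rightarrow> nat set \<Rightarrow> nat list set" where
  "descent_words n J =
     {xs \<in> permutations_of_set {1..n}. successively (\<lambda>x y. y < x \<longrightarrow> y \<in> J) xs}"

lemma descent_words_iff:
  "xs \<in> descent_words n J \<longleftrightarrow>
     set xs = {1..n} \<and> distinct xs \<and> successively (\<lambda>x y. y < x \<longrightarrow> y \<in> J) xs"
  unfolding descent_words_def permutations_of_set_def by simp

lemma finite_descent_words: "finite (descent_words n J)"
  unfolding descent_words_def by simp

text \<open>One may cut at the end or just before a letter of \<open>J\<close>. These are the places
  open to a new largest letter.\<close>

lemma card_splits:
  assumes "distinct xs"
  shows "card {(ys, zs). xs = ys @ zs \<and> (zs = [] \<or> hd zs \<in> J)} = Suc (card (J \<inter> set xs))"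
  using assms
proof (induction xs)
  case Nil
  have "{(ys, zs). [] = ys @ zs \<and> (zs = [] \<or> hd zs \<in> J)} = {([], [])}" by auto
  then show ?case by simp
next
  case (Cons x xs)
  let ?S = "\<lambda>xs. {(ys, zs). xs = ys @ zs \<and> (zs = [] \<or> hd zs \<in> J)}"
  \<comment> \<open>By the induction hypothesis the cardinality is positive, which excludes infinite
    sets.\<close>
  have fin: "finite (?S xs)"
    using Cons by (intro card_ge_0_finite) simp
  have "?S (x # xs) = (\<lambda>(ys, zs). (x # ys, zs)) ` ?S xs \<union> (if x \<in> J then {([], x # xs)} else {})"
    by (auto simp: Cons_eq_append_conv image_iff split: if_splits)
  moreover have "card ((\<lambda>(ys, zs). (x # ys, zs)) ` ?S xs) = card (?S xs)"
    by (intro card_image inj_onI) auto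
  moreover have "card (J \<inter> set (x # xs)) = card (J \<inter> set xs) + (if x \<in> J then 1 else 0)"
    using Cons.prems by (auto simp: Int_insert_right)
  ultimately show ?case
    using Cons fin by (auto simp: image_iff)
qed

text \<open>Inserting a new largest letter makes its right neighbour a descent bottom and changes
  nothing else, because the remaining descent bottoms persist.\<close>

lemma card_descent_words_Suc:
  "card (descent_words (Suc n) J) = card (descent_words n J) * Suc (card (J \<inter> {1..n}))"
proof -
  let ?S = "\<lambda>xs. {(ys, zs). xs = ys @ zs \<and> (zs = [] \<or> hd zs \<in> J)}"
  let ?P = "\<lambda>x y. y < x \<longrightarrow> y \<in> (J :: nat set)"
  \<comment> \<open>The ascent into \<open>Suc n\<close> is unconstrained and the descent out of it
    demands \<open>hd zs \<in> J\<close>. The same membership settles the step from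
    \<open>last ys\<close> to \<open>hd zs\<close> once \<open>Suc n\<close> is removed.\<close>
  have succ: "successively ?P (ys @ Suc n # zs) \<longleftrightarrow>
      successively ?P (ys @ zs) \<and> (zs = [] \<or> hd zs \<in> J)"
    if "set (ys @ zs) = {1..n}" for ys zs
  proof -
    have "\<forall>y\<in>set ys. y \<le> n" "zs \<noteq> [] \<Longrightarrow> hd zs \<le> n" using that hd_in_set[of zs] by auto
    then have "ys = [] \<or> last ys \<le> n" "zs = [] \<or> hd zs \<le> n" using last_in_set by blast+
    then have "ys = [] \<or> \<not> Suc n < last ys" "zs = [] \<or> hd zs < Suc n" by auto
    then show ?thesis
      unfolding successively_append_iff successively_Cons list.sel
      by (cases "zs = []"; simp; blast)
  qed
  let ?D = "SIGMA xs:descent_words n J. ?S xs"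
  let ?f = "\<lambda>(xs, ys, zs). ys @ Suc n # zs"
  have "bij_betw ?f ?D (descent_words (Suc n) J)"
    unfolding bij_betw_def
  proof
    show "inj_on ?f ?D"
    proof (rule inj_onI, clarsimp)
      fix ys zs ys' zs'
      assume "ys @ zs \<in> descent_words n J" "ys' @ zs' \<in> descent_words n J"
        and eq: "ys @ Suc n # zs = ys' @ Suc n # zs'"
      then have "set (ys @ zs) = {1..n}" "set (ys' @ zs') = {1..n}"
        unfolding descent_words_def permutations_of_set_def by auto
      then have "Suc n \<notin> set (ys @ zs)" "Suc n \<notin> set (ys' @ zs')" by simp_all
      then have "Suc n \<notin> set ys" "Suc n \<notin> set ys'" "Suc n \<notin> set zs" "Suc n \<notin> set zs'" by simp_all
      with eq show "ys @ zs = ys' @ zs' \<and> ys = ys' \<and> zs = zs'"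
        using append_Cons_eq_iff[of "Suc n" ys zs ys' zs'] by blast
    qed
    show "?f ` ?D = descent_words (Suc n) J"
    proof (intro equalityI subsetI)
      fix xs assume "xs \<in> ?f ` ?D"
      then obtain ys zs where xs: "xs = ys @ Suc n # zs" and w: "ys @ zs \<in> descent_words n J"
        and hd: "zs = [] \<or> hd zs \<in> J" by auto
      note yz = w[unfolded descent_words_iff]
      then have "Suc n \<notin> set (ys @ zs)" by simp
      then have "distinct xs" using yz unfolding xs by simp
      moreover have "set xs = insert (Suc n) (set (ys @ zs))" unfolding xs by simp
      then have "set xs = {1..Suc n}" using yz by (simp add: atLeastAtMostSuc_conv)
      ultimately show "xs \<in> descent_words (Suc n) J"
        using succ[of ys zs] yz hd unfolding descent_words_iff xs by blast
    next
      fix xs assume "xs \<in> descent_words (Suc n) J"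
      note xs = this[unfolded descent_words_iff]
      then have "Suc n \<in> set xs" by simp
      then obtain ys zs where e: "xs = ys @ Suc n # zs" by (meson split_list)
      have "insert (Suc n) (set (ys @ zs)) = {1..Suc n}" using xs unfolding e by simp
      moreover have "Suc n \<notin> set (ys @ zs)" and d: "distinct (ys @ zs)" using xs unfolding e by simp_all
      ultimately have "set (ys @ zs) = {1..Suc n} - {Suc n}" by blast
      also have "\<dots> = {1..n}" by auto
      finally have s: "set (ys @ zs) = {1..n}" .
      have "ys @ zs \<in> descent_words n J" "zs = [] \<or> hd zs \<in> J"
        using xs s d succ[OF s] unfolding descent_words_iff e by blast+
      then have "(ys @ zs, ys, zs) \<in> ?D" by simp
      then show "xs \<in> ?f ` ?D" unfolding e by (rule rev_image_eqI) simp
    qed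
  qed
  then have "card (descent_words (Suc n) J) = card ?D" by (simp add: bij_betw_same_card)
  also have "\<dots> = (\<Sum>xs\<in>descent_words n J. card (?S xs))"
  proof (rule card_SigmaI[OF finite_descent_words], rule ballI)
    fix xs assume "xs \<in> descent_words n J"
    then have "card (?S xs) = Suc (card (J \<inter> set xs))"
      unfolding descent_words_def permutations_of_set_def by (intro card_splits) auto
    then show "finite (?S xs)" by (intro card_ge_0_finite) simp
  qed
  also have "\<dots> = (\<Sum>xs\<in>descent_words n J. Suc (card (J \<inter> {1..n})))"
    by (rule sum.cong[OF refl], subst card_splits) (auto simp: descent_words_def permutations_of_set_def)
  finally show ?thesis by simp
qed

text \<open>The factor at \<open>v\<close> counts the places for the letter \<open>Suc v\<close>; at
  \<open>v = 0\<close> it is 1.\<close>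

lemma card_descent_words:
  "card (descent_words n J) = (\<Prod>v<n. Suc (card (J \<inter> {1..v})))"
proof (induction n)
  case 0
  have "descent_words 0 J = {[]}" unfolding descent_words_def permutations_of_set_def by auto
  then show ?case by simp
next
  case (Suc n)
  then show ?case by (simp only: card_descent_words_Suc prod.lessThan_Suc)
qed

lemma card_permutes_descent_bottoms_in:
  "card {\<pi>. \<pi> permutes {1..n} \<and> descent_bottoms_in n J \<pi>} = (\<Prod>v<n. Suc (card (J \<inter> {1..v})))"
proof -
  let ?A = "{\<pi>. \<pi> permutes {1..n} \<and> descent_bottoms_in n J \<pi>}"
  let ?w = "\<lambda>\<pi>. map (\<lambda>k. \<pi> (Suc k)) [0..<n]"
  have desc: "descent_bottoms_in n J \<pi> \<longleftrightarrow> successively (\<lambda>x y. y < x \<longrightarrow> y \<in> J) (?w \<pi>)" for \<pi>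
  proof -
    have "descent_bottoms_in n J \<pi> \<longleftrightarrow>
        (\<forall>k. Suc k < n \<longrightarrow> \<pi> (Suc (Suc k)) < \<pi> (Suc k) \<longrightarrow> \<pi> (Suc (Suc k)) \<in> J)"
      unfolding descent_bottoms_in_def
      by (auto simp: Ball_def Suc_le_eq gr0_conv_Suc)
    then show ?thesis by (auto simp: successively_conv_nth)
  qed
  have img: "(\<lambda>k. \<pi> (Suc k)) ` {0..<n} = \<pi> ` {1..n}" for \<pi> :: "nat \<Rightarrow> nat"
    by (metis image_image image_Suc_atLeastLessThan One_nat_def atLeastLessThanSuc_atLeastAtMost)
  have "bij_betw ?w ?A (descent_words n J)"
    unfolding bij_betw_def
  proof
    show "inj_on ?w ?A"
    proof (rule inj_onI)
      fix \<pi> \<rho> assume "\<pi> \<in> ?A" "\<rho> \<in> ?A" and eq: "?w \<pi> = ?w \<rho>"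
      then have perm: "\<pi> permutes {1..n}" "\<rho> permutes {1..n}" by blast+
      show "\<pi> = \<rho>"
      proof
        fix k
        show "\<pi> k = \<rho> k"
        proof (cases "k \<in> {1..n}")
          case True
          then obtain l where "k = Suc l" "l < n" by (cases k) auto
          then show ?thesis using eq by simp
        next
          case False
          then show ?thesis using perm[THEN permutes_not_in] by simp
        qed
      qed
    qed
    show "?w ` ?A = descent_words n J"
    proof (intro equalityI subsetI)
      fix xs assume "xs \<in> ?w ` ?A"
      then obtain \<pi> where \<pi>: "\<pi> permutes {1..n}" "descent_bottoms_in n J \<pi>" and xs: "xs = ?w \<pi>"
        by auto
      have "set xs = {1..n}" unfolding xs using img[of \<pi>] \<pi> by (simp add: permutes_image)
      moreover have "distinct xs"
        unfolding xs distinct_map by (simp add: inj_on_def inj_eq[OF permutes_inj[OF \<pi>(1)]])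
      ultimately show "xs \<in> descent_words n J"
        using \<pi> desc[of \<pi>] unfolding descent_words_iff xs by blast
    next
      fix xs assume xs: "xs \<in> descent_words n J"
      then have s: "set xs = {1..n}" "distinct xs" "successively (\<lambda>x y. y < x \<longrightarrow> y \<in> J) xs"
        unfolding descent_words_iff by simp_all
      have "length xs = card {1..n}" using distinct_card[OF s(2)] unfolding s(1) by (rule sym)
      then have len: "length xs = n" by simp
      \<comment> \<open>Lists are indexed from 0, and outside \<open>{1..n}\<close> the identity is
        what \<open>permutes\<close> requires.\<close>
      define \<pi> where "\<pi> k = (if k \<in> {1..n} then xs ! (k - 1) else k)" for k
      have w: "?w \<pi> = xs" unfolding \<pi>_def using len by (intro nth_equalityI) auto
      have "\<pi> ` {1..n} = {1..n}" using s(1) img[of \<pi>] w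
        by (metis list.set_map set_upt)
      then have "bij_betw \<pi> {1..n} {1..n}"
        unfolding bij_betw_def by (simp add: eq_card_imp_inj_on)
      then have "\<pi> permutes {1..n}" by (rule bij_imp_permutes) (auto simp: \<pi>_def)
      moreover have "descent_bottoms_in n J \<pi>" using desc[of \<pi>] w s(3) by simp
      ultimately show "xs \<in> ?w ` ?A" using w by (metis (mono_tags, lifting) image_eqI mem_Collect_eq)
    qed
  qed
  then show ?thesis using card_descent_words bij_betw_same_card by metis
qed

subsection \<open>Excedant functions covering a set\<close>

text \<open>For \<open>X = {}\<close> these are the excedant functions on \<open>{1..m}\<close>
  whose image contains \<open>K\<close>. The set \<open>X\<close> is meant for values above
  \<open>m\<close>, allowed at every argument.\<close>

definition excedant_covers :: "nat \<Rightarrow> nat set \<Rightarrow> nat set \<Rightarrow> (nat \<Rightarrow> nat) set" where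
  "excedant_covers m X K = {h \<in> PiE {1..m} (\<lambda>a. {a..m} \<union> X). K \<subseteq> h ` {1..m}}"

lemma finite_excedant_covers: "finite X \<Longrightarrow> finite (excedant_covers m X K)"
  unfolding excedant_covers_def by (auto intro!: finite_PiE)

text \<open>Functions in \<open>H\<close> are \<open>undefined\<close> at \<open>a\<close>, so the
  update there loses no information.\<close>

lemma card_image_fun_upd:
  assumes "a \<notin> S" "H \<subseteq> PiE S T"
  shows "card ((\<lambda>(y, g). g(a := y)) ` (Y \<times> H)) = card Y * card H"
proof -
  have "inj_on (\<lambda>(y, g). g(a := y)) (Y \<times> H)"
  proof (rule inj_onI, clarify)
    fix y y' g g' assume g: "g \<in> H" "g' \<in> H" and eq: "g(a := y) = g'(a := y')"
    have "g k = g' k" for k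
    proof (cases "k = a")
      case True
      then show ?thesis using assms g by (metis PiE_arb subsetD)
    next
      case False
      then show ?thesis using fun_cong[OF eq, of k] by simp
    qed
    then show "y = y' \<and> g = g'" using fun_cong[OF eq, of a] by auto
  qed
  then show ?thesis by (simp add: card_image card_cartesian_product)
qed

text \<open>The argument \<open>Suc m\<close> takes the value \<open>Suc m\<close> or one in
  \<open>X\<close>, hence none in \<open>{1..m}\<close>, and covering \<open>K\<close> is left to
  smaller arguments. For these \<open>Suc m\<close> is always allowed, so it joins \<open>X\<close>,
  unless the functions are required to miss it.\<close>

lemma excedant_covers_Suc:
  assumes "K \<subseteq> {1..m}" "X \<inter> {1..Suc m} = {}"
  shows "excedant_covers (Suc m) X K =
      (\<lambda>(y, g). g(Suc m := y)) ` (insert (Suc m) X \<times> excedant_covers m (insert (Suc m) X) K)" (is ?A)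
    and "{h \<in> excedant_covers (Suc m) X K. Suc m \<notin> h ` {1..Suc m}} =
      (\<lambda>(y, g). g(Suc m := y)) ` (X \<times> excedant_covers m X K)" (is ?B)
proof -
  have ins: "{1..Suc m} = insert (Suc m) {1..m}" by auto
  have P: "PiE {1..Suc m} (\<lambda>a. {a..Suc m} \<union> X) = (\<lambda>(y, g). g(Suc m := y)) `
      (insert (Suc m) X \<times> PiE {1..m} (\<lambda>a. {a..m} \<union> insert (Suc m) X))"
  proof -
    have "PiE {1..m} (\<lambda>a. {a..Suc m} \<union> X) = PiE {1..m} (\<lambda>a. {a..m} \<union> insert (Suc m) X)"
      by (rule PiE_cong) auto
    then show ?thesis unfolding ins PiE_insert_eq by simp
  qed
  have img: "(g(Suc m := y)) ` {1..Suc m} = insert y (g ` {1..m})" for g :: "nat \<Rightarrow> nat" and y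
    unfolding ins by auto
  have K: "K \<subseteq> insert y S \<longleftrightarrow> K \<subseteq> S" if "y \<in> insert (Suc m) X" for y S
    using that assms by fastforce
  have filter_image: "{h \<in> (\<lambda>(y, g). g(Suc m := y)) ` (Y \<times> P). Q h} =
      (\<lambda>(y, g). g(Suc m := y)) ` (Y' \<times> P')"
    if "\<And>y g. (y \<in> Y \<and> g \<in> P) \<and> Q (g(Suc m := y)) \<longleftrightarrow> y \<in> Y' \<and> g \<in> P'"
    for Y Y' :: "nat set" and P P' :: "(nat \<Rightarrow> nat) set" and Q
  proof -
    have "{x \<in> Y \<times> P. Q (case x of (y, g) \<Rightarrow> g(Suc m := y))} = Y' \<times> P'"
      by (rule set_eqI) (simp only: mem_Collect_eq mem_Times_iff case_prod_beta that)
    then show ?thesis by (simp only: Compr_image_eq)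
  qed
  show ?A
    unfolding excedant_covers_def P
    by (rule filter_image) (use K in \<open>simp only: img mem_Collect_eq, blast\<close>)
  have avoid: "g \<in> PiE {1..m} (\<lambda>a. {a..m} \<union> insert (Suc m) X) \<and> Suc m \<notin> g ` {1..m} \<longleftrightarrow>
      g \<in> PiE {1..m} (\<lambda>a. {a..m} \<union> X)" for g
  proof -
    have "z \<in> {a..m} \<union> insert (Suc m) X \<and> Suc m \<noteq> z \<longleftrightarrow> z \<in> {a..m} \<union> X" for z a
      using assms(2) by auto
    then show ?thesis unfolding PiE_iff by blast
  qed
  have X: "Suc m \<notin> X" using assms(2) by auto
  show ?B
    unfolding excedant_covers_def P mem_Collect_eq conj_assoc
    by (rule filter_image) (use X K in \<open>simp only: img mem_Collect_eq avoid[symmetric], blast\<close>)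
qed

text \<open>The extra values \<open>X\<close>, which need not be covered, make the induction work: a value \<open>m\<close>
  in \<open>J\<close> becomes such an extra value for the smaller arguments, and for \<open>m\<close> not in \<open>J\<close>
  one subtracts the functions that miss \<open>m\<close>.\<close>

lemma card_excedant_covers:
  assumes "finite X" "X \<inter> {1..m} = {}"
  shows "card (excedant_covers m X ({1..m} - J)) =
    (\<Prod>v\<in>{1..m} - J. Suc (card (J \<inter> {1..v}))) * pochhammer (Suc (card X)) (card (J \<inter> {1..m}))"
  using assms
proof (induction m arbitrary: X)
  case 0
  have "excedant_covers 0 X {} = {\<lambda>_. undefined}" unfolding excedant_covers_def by auto
  then show ?case by simp
next
  case (Suc m)
  let ?K = "{1..m} - J"
  let ?P = "\<Prod>v\<in>?K. Suc (card (J \<inter> {1..v}))"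
  let ?j = "card (J \<inter> {1..m})"
  have nX: "Suc m \<notin> X" "X \<inter> {1..m} = {}" "insert (Suc m) X \<inter> {1..m} = {}" using Suc.prems by auto
  have sub: "excedant_covers m Y ?K \<subseteq> PiE {1..m} (\<lambda>a. {a..m} \<union> Y)" for Y
    unfolding excedant_covers_def by auto
  \<comment> \<open>The last argument has \<open>Suc (card X)\<close> values, which is the first
    factor of the Pochhammer symbol; enlarging \<open>X\<close> by one element shifts its start for
    the remaining factors.\<close>
  have all: "card (excedant_covers (Suc m) X ?K) = ?P * pochhammer (Suc (card X)) (Suc ?j)"
  proof -
    have "card (excedant_covers (Suc m) X ?K) =
        Suc (card X) * card (excedant_covers m (insert (Suc m) X) ?K)"
      unfolding excedant_covers_Suc(1)[OF Diff_subset Suc.prems(2)]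
      by (subst card_image_fun_upd[OF _ sub]) (use nX Suc.prems in auto)
    then show ?thesis
      using Suc.IH[of "insert (Suc m) X"] Suc.prems nX
      by (simp add: pochhammer_rec algebra_simps)
  qed
  show ?case
  proof (cases "Suc m \<in> J")
    case True
    \<comment> \<open>The set to be covered is unchanged and the length of the Pochhammer symbol
      grows by one, so \<open>all\<close> is the claim.\<close>
    then have "{1..Suc m} - J = ?K" "J \<inter> {1..Suc m} = insert (Suc m) (J \<inter> {1..m})"
      using le_Suc_eq by auto
    then show ?thesis using all by simp
  next
    case False
    then have eq: "{1..Suc m} - J = insert (Suc m) ?K" "J \<inter> {1..Suc m} = J \<inter> {1..m}"
      using le_Suc_eq by auto
    let ?B = "{h \<in> excedant_covers (Suc m) X ?K. Suc m \<notin> h ` {1..Suc m}}"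
    have "card ?B = card X * card (excedant_covers m X ?K)"
      unfolding excedant_covers_Suc(2)[OF Diff_subset Suc.prems(2)]
      by (subst card_image_fun_upd[OF _ sub]) auto
    then have B: "card ?B = card X * (?P * pochhammer (Suc (card X)) ?j)"
      using Suc.IH[of X] Suc.prems nX by simp
    have "excedant_covers (Suc m) X ?K = excedant_covers (Suc m) X ({1..Suc m} - J) \<union> ?B"
      unfolding eq excedant_covers_def by auto
    moreover have "excedant_covers (Suc m) X ({1..Suc m} - J) \<inter> ?B = {}"
      unfolding eq excedant_covers_def by auto
    ultimately have "card (excedant_covers (Suc m) X ({1..Suc m} - J)) + card ?B =
        ?P * pochhammer (Suc (card X)) (Suc ?j)"
      using all card_Un_disjoint[of "excedant_covers (Suc m) X ({1..Suc m} - J)" ?B]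
        finite_excedant_covers[OF Suc.prems(1)] by auto
    \<comment> \<open>The last Pochhammer factor is \<open>Suc (card X) + ?j\<close>, and
      subtracting the \<open>card X\<close> from \<open>?B\<close> leaves \<open>Suc ?j\<close>, the
      new factor at \<open>v = Suc m\<close>.\<close>
    then have "card (excedant_covers (Suc m) X ({1..Suc m} - J)) =
        Suc ?j * (?P * pochhammer (Suc (card X)) ?j)"
      unfolding B pochhammer_Suc by (simp add: algebra_simps)
    then show ?thesis unfolding eq(1) by (simp add: eq(2)[unfolded One_nat_def] algebra_simps)
  qed
qed

text \<open>On the right, let \<open>v\<close> belong to the letter \<open>w = Suc v\<close>. If
  \<open>w \<notin> J\<close>, the count up to \<open>v\<close> equals the count up to
  \<open>w\<close>; if \<open>w \<in> J\<close>, the factor is the rank of \<open>w\<close> in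
  \<open>J\<close>, and these ranks multiply to the factorial.\<close>

lemma prod_Suc_card_split:
  fixes J :: "nat set"
  shows "(\<Prod>v\<in>{1..m} - J. Suc (card (J \<inter> {1..v}))) * fact (card (J \<inter> {1..m})) =
    (\<Prod>v<m. Suc (card (J \<inter> {1..v})))"
proof (induction m)
  case 0
  show ?case by simp
next
  case (Suc m)
  show ?case
  proof (cases "Suc m \<in> J")
    case True
    then have "{1..Suc m} - J = {1..m} - J" "J \<inter> {1..Suc m} = insert (Suc m) (J \<inter> {1..m})"
      using le_Suc_eq by auto
    then show ?thesis using Suc by (simp add: algebra_simps)
  next
    case False
    then have "{1..Suc m} - J = insert (Suc m) ({1..m} - J)" "J \<inter> {1..Suc m} = J \<inter> {1..m}"
      using le_Suc_eq by auto
    then show ?thesis using Suc by (simp add: algebra_simps)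
  qed
qed

text \<open>For \<open>X = {}\<close> the Pochhammer symbol starts at 1 and is the factorial above.
  The result is the product that counts descent words.\<close>

lemma card_excedant_covers_empty:
  "card (excedant_covers m {} ({1..m} - J)) = (\<Prod>v<m. Suc (card (J \<inter> {1..v})))"
  using card_excedant_covers[of "{}" m J] prod_Suc_card_split[of J m]
  by (simp add: pochhammer_fact)

subsection \<open>Values at odd and at even arguments\<close>

lemma odd_even_cases:
  fixes x :: nat
  assumes "x \<in> {1..2 * m + 1}"
  obtains (odd) k where "k \<le> m" "x = Suc (2 * k)" | (even) k where "k \<in> {1..m}" "x = 2 * k"
proof (cases "even x")
  case True
  then obtain k where "x = 2 * k" by (elim evenE)
  then show ?thesis using assms by (intro even[of k]) auto
next
  case False
  then obtain k where "x = 2 * k + 1" by (elim oddE)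
  then show ?thesis using assms by (intro odd[of k]) auto
qed

text \<open>The argument \<open>2 * u - 1\<close> encodes \<open>p u\<close>: a parent
  \<open>b\<close> becomes the value \<open>2 * (b - 1)\<close> and \<infinity> the top value. Being
  excedant there means exactly \<open>b > u\<close>. Even arguments carry \<open>g\<close>
  doubled.\<close>

definition interleave :: "nat \<Rightarrow> (nat \<Rightarrow> enat) \<Rightarrow> (nat \<Rightarrow> nat) \<Rightarrow> nat \<Rightarrow> nat" where
  "interleave m p g = (\<lambda>x\<in>{1..2 * m + 1}.
     if even x then 2 * g (x div 2)
     else case p (Suc (x div 2)) of enat b \<Rightarrow> 2 * (b - 1) | \<infinity> \<Rightarrow> 2 * m + 1)"

definition odd_part :: "nat \<Rightarrow> (nat \<Rightarrow> nat) \<Rightarrow> nat \<Rightarrow> enat" where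
  "odd_part m f = (\<lambda>u\<in>{1..Suc m}.
     if f (2 * u - 1) = 2 * m + 1 then \<infinity> else enat (Suc (f (2 * u - 1) div 2)))"

definition even_part :: "nat \<Rightarrow> (nat \<Rightarrow> nat) \<Rightarrow> nat \<Rightarrow> nat" where
  "even_part m f = (\<lambda>k\<in>{1..m}. f (2 * k) div 2)"

lemma interleave_odd:
  "k \<le> m \<Longrightarrow> interleave m p g (Suc (2 * k)) =
     (case p (Suc k) of enat b \<Rightarrow> 2 * (b - 1) | \<infinity> \<Rightarrow> 2 * m + 1)"
  unfolding interleave_def by simp

lemma interleave_even: "k \<in> {1..m} \<Longrightarrow> interleave m p g (2 * k) = 2 * g k"
  unfolding interleave_def by simp

lemma odd_part_Suc:
  "k \<le> m \<Longrightarrow> odd_part m f (Suc k) =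
     (if f (Suc (2 * k)) = 2 * m + 1 then \<infinity> else enat (Suc (f (Suc (2 * k)) div 2)))"
  unfolding odd_part_def by simp

lemma even_part_eq: "k \<in> {1..m} \<Longrightarrow> even_part m f k = f (2 * k) div 2"
  unfolding even_part_def by simp

text \<open>The top value occurs at odd arguments only, where it marks \<infinity>. The abstract
  \<open>f\<close> and \<open>p\<close> let this serve both directions of the bijection.\<close>

lemma card_top_preimage:
  assumes odd: "\<And>k. k \<le> m \<Longrightarrow> f (Suc (2 * k)) = t \<longleftrightarrow> p (Suc k) = (\<infinity> :: enat)"
    and even: "\<And>k. k \<in> {1..m} \<Longrightarrow> f (2 * k) \<noteq> t"
  shows "card {x \<in> {1..2 * m + 1}. f x = t} = card {u \<in> {1..Suc m}. p u = \<infinity>}"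
proof -
  have "bij_betw (\<lambda>u. 2 * u - 1) {u \<in> {1..Suc m}. p u = \<infinity>} {x \<in> {1..2 * m + 1}. f x = t}"
    unfolding bij_betw_def
  proof (intro conjI equalityI subsetI)
    show "inj_on (\<lambda>u. 2 * u - 1) {u \<in> {1..Suc m}. p u = \<infinity>}" by (rule inj_onI) auto
  next
    fix x assume "x \<in> (\<lambda>u. 2 * u - 1) ` {u \<in> {1..Suc m}. p u = \<infinity>}"
    then obtain u where u: "u \<in> {1..Suc m}" "p u = \<infinity>" "x = 2 * u - 1" by blast
    then obtain k where "u = Suc k" "k \<le> m" by (cases u) auto
    then show "x \<in> {x \<in> {1..2 * m + 1}. f x = t}" using u odd[of k] by simp
  next
    fix x assume "x \<in> {x \<in> {1..2 * m + 1}. f x = t}"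
    then have x: "x \<in> {1..2 * m + 1}" "f x = t" by simp_all
    from x(1) obtain k where k: "k \<le> m" "x = Suc (2 * k)"
      by (rule odd_even_cases) (use x(2) even in auto)
    then have "Suc k \<in> {u \<in> {1..Suc m}. p u = \<infinity>}" "x = 2 * Suc k - 1" using odd[of k] x(2) by simp_all
    then show "x \<in> (\<lambda>u. 2 * u - 1) ` {u \<in> {1..Suc m}. p u = \<infinity>}" by blast
  qed
  from bij_betw_same_card[OF this] show ?thesis by simp
qed

section \<open>The bijection between excedant functions and pairs\<close>

text \<open>The functions of the theorem for \<open>n = Suc m\<close>, which removes the truncated
  subtractions.\<close>

definition excedant_doublings :: "nat \<Rightarrow> nat \<Rightarrow> (nat \<Rightarrow> nat) set" where
  "excedant_doublings m i = {f \<in> excedant_functions (2 * m + 1).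
     (\<forall>k\<in>{1..m}. f (2 * k) \<le> 2 * m) \<and>
     f ` {1..2 * m + 1} = (\<lambda>k. 2 * k) ` {1..m} \<union> {2 * m + 1} \<and>
     card {x \<in> {1..2 * m + 1}. f x = 2 * m + 1} = i}"

text \<open>The value \<open>2 * r\<close> must occur at an odd argument, where it says that
  \<open>Suc r\<close> is a parent, or at an even one, where it says that \<open>r\<close> is a
  value of \<open>g\<close>. So \<open>g\<close> has to cover what \<open>p\<close> misses.\<close>

definition split_pairs :: "nat \<Rightarrow> nat \<Rightarrow> ((nat \<Rightarrow> enat) \<times> (nat \<Rightarrow> nat)) set" where
  "split_pairs m i =
     (SIGMA p:{p. parent_function (Suc m) p \<and> card {u \<in> {1..Suc m}. p u = \<infinity>} = i}.
        excedant_covers m {} ({1..m} - {r. Suc r \<in> finite_parents (Suc m) p}))"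

lemma parent_function_cases:
  assumes "parent_function (Suc m) p" "k \<le> m"
  obtains (top) "p (Suc k) = \<infinity>" | (finite) l where "p (Suc k) = enat (Suc l)" "k < l" "l \<le> m"
proof -
  have k: "Suc k \<in> {1..Suc m}" using assms(2) by simp
  then have "p (Suc k) \<in> enat ` {2..Suc m} \<union> {\<infinity>}" "p (Suc k) > enat (Suc k)"
    using assms(1) unfolding parent_function_def by blast+
  then show thesis
  proof (cases "p (Suc k)")
    case (enat b)
    then have "b \<in> {2..Suc m}" "Suc k < b"
      using \<open>p (Suc k) \<in> _\<close> \<open>p (Suc k) > _\<close> by auto
    then show thesis using enat by (intro finite[of "b - 1"]) auto
  qed (rule top)
qed

text \<open>An even value \<open>2 * l\<close> that is at least \<open>2 * k + 1\<close> has
  \<open>l > k\<close>: this is where the strict inequality of parent functions comes from.\<close>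

lemma excedant_doublings_odd:
  assumes "f \<in> excedant_doublings m i" "k \<le> m"
  obtains (top) "f (Suc (2 * k)) = 2 * m + 1"
    | (below) l where "f (Suc (2 * k)) = 2 * l" "k < l" "l \<le> m"
proof -
  have k: "Suc (2 * k) \<in> {1..2 * m + 1}" using assms(2) by simp
  then have "f (Suc (2 * k)) \<ge> Suc (2 * k)"
    using assms(1) unfolding excedant_doublings_def excedant_functions_def by blast
  moreover have "f (Suc (2 * k)) \<in> (\<lambda>k. 2 * k) ` {1..m} \<union> {2 * m + 1}"
    using imageI[OF k, of f] assms(1) unfolding excedant_doublings_def by blast
  ultimately show thesis using top below by auto
qed

text \<open>The bound \<open>2 * m\<close> excludes the only odd value in the image, so halving is
  exact.\<close>

lemma excedant_doublings_even:
  assumes "f \<in> excedant_doublings m i" "k \<in> {1..m}"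
  obtains l where "f (2 * k) = 2 * l" "k \<le> l" "l \<le> m"
proof -
  have k: "2 * k \<in> {1..2 * m + 1}" using assms(2) by simp
  then have "f (2 * k) \<ge> 2 * k"
    using assms(1) unfolding excedant_doublings_def excedant_functions_def by blast
  moreover have "f (2 * k) \<in> (\<lambda>k. 2 * k) ` {1..m} \<union> {2 * m + 1}"
    using imageI[OF k, of f] assms(1) unfolding excedant_doublings_def by blast
  moreover have "f (2 * k) \<le> 2 * m"
    using assms unfolding excedant_doublings_def by blast
  ultimately show thesis using that by auto
qed

lemma interleave_in_excedant_doublings:
  assumes "(p, g) \<in> split_pairs m i"
  shows "interleave m p g \<in> excedant_doublings m i"
proof -
  let ?f = "interleave m p g"
  let ?J = "{r. Suc r \<in> finite_parents (Suc m) p}"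
  have p: "parent_function (Suc m) p" "card {u \<in> {1..Suc m}. p u = \<infinity>} = i"
    and g: "g \<in> PiE {1..m} (\<lambda>a. {a..m})" "{1..m} - ?J \<subseteq> g ` {1..m}"
    using assms unfolding split_pairs_def excedant_covers_def by auto
  have g_bounds: "k \<le> g k" "g k \<le> m" if "k \<in> {1..m}" for k using PiE_mem[OF g(1) that] by auto
  have vals: "?f x \<in> (\<lambda>k. 2 * k) ` {1..m} \<union> {2 * m + 1} \<and> x \<le> ?f x"
    if "x \<in> {1..2 * m + 1}" for x
    using that
  proof (cases rule: odd_even_cases)
    case (odd k)
    show ?thesis using p(1) odd(1)
    proof (cases rule: parent_function_cases)
      case top
      then show ?thesis using odd by (simp add: interleave_odd)
    next
      case (finite l)
      then show ?thesis using odd by (auto simp: interleave_odd)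
    qed
  next
    case (even k)
    then show ?thesis using g_bounds[OF even(1)] by (auto simp: interleave_even)
  qed
  have "?f \<in> excedant_functions (2 * m + 1)"
    unfolding excedant_functions_def
  proof (intro CollectI conjI ballI PiE_I)
    fix x assume x: "x \<in> {1..2 * m + 1}"
    show "x \<le> ?f x" "?f x \<in> {1..2 * m + 1}" using vals[OF x] x by auto
  qed (auto simp: interleave_def)
  moreover have "\<forall>k\<in>{1..m}. ?f (2 * k) \<le> 2 * m"
    using g_bounds by (simp add: interleave_even)
  moreover have "?f ` {1..2 * m + 1} = (\<lambda>k. 2 * k) ` {1..m} \<union> {2 * m + 1}"
  proof (intro equalityI subsetI)
    fix y assume "y \<in> ?f ` {1..2 * m + 1}"
    then show "y \<in> (\<lambda>k. 2 * k) ` {1..m} \<union> {2 * m + 1}" using vals by blast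
  next
    fix y assume "y \<in> (\<lambda>k. 2 * k) ` {1..m} \<union> {2 * m + 1}"
    then consider (top) "y = 2 * m + 1" | (hit) r where "r \<in> {1..m} - ?J" "y = 2 * r"
      | (parent) r where "r \<in> ?J" "y = 2 * r" "r \<in> {1..m}" by blast
    then show "y \<in> ?f ` {1..2 * m + 1}"
    proof cases
      case top
      \<comment> \<open>No finite parent exceeds \<open>Suc m\<close>, so the top value is always
        attained at the last argument.\<close>
      have "p (Suc m) = \<infinity>" using p(1) le_refl by (cases rule: parent_function_cases) auto
      then have "y = ?f (Suc (2 * m))" using top by (simp add: interleave_odd)
      then show ?thesis by (rule image_eqI) simp
    next
      case hit
      then obtain k where "k \<in> {1..m}" "g k = r" using g(2) by blast
      then have "y = ?f (2 * k)" "2 * k \<in> {1..2 * m + 1}" using hit by (auto simp: interleave_even)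
      then show ?thesis by (rule image_eqI)
    next
      case parent
      then obtain u where u: "u \<in> {1..Suc m}" "p u = enat (Suc r)" unfolding finite_parents_def by auto
      then obtain k where "u = Suc k" "k \<le> m" by (cases u) auto
      then have "y = ?f (Suc (2 * k))" "Suc (2 * k) \<in> {1..2 * m + 1}"
        using parent u by (simp_all add: interleave_odd)
      then show ?thesis by (rule image_eqI)
    qed
  qed
  moreover have "card {x \<in> {1..2 * m + 1}. ?f x = 2 * m + 1} = i"
  proof (subst card_top_preimage[of m ?f _ p])
    fix k assume "k \<le> m"
    with p(1) show "?f (Suc (2 * k)) = 2 * m + 1 \<longleftrightarrow> p (Suc k) = \<infinity>"
      by (cases rule: parent_function_cases) (auto simp: interleave_odd \<open>k \<le> m\<close>)
  next
    fix k assume "k \<in> {1..m}"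
    then show "?f (2 * k) \<noteq> 2 * m + 1" using g_bounds(2)[of k] by (simp add: interleave_even)
  qed (rule p(2))
  ultimately show ?thesis unfolding excedant_doublings_def by blast
qed

lemma parts_in_split_pairs:
  assumes f: "f \<in> excedant_doublings m i"
  shows "(odd_part m f, even_part m f) \<in> split_pairs m i"
proof -
  let ?p = "odd_part m f" and ?g = "even_part m f"
  have p: "?p (Suc k) \<in> enat ` {2..Suc m} \<union> {\<infinity>} \<and> enat (Suc k) < ?p (Suc k) \<and>
      (f (Suc (2 * k)) = 2 * m + 1 \<longleftrightarrow> ?p (Suc k) = \<infinity>)" if k: "k \<le> m" for k
    using f k by (cases rule: excedant_doublings_odd) (auto simp: odd_part_Suc k)
  have "parent_function (Suc m) ?p"
    unfolding parent_function_def
  proof (intro conjI PiE_I ballI)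
    fix u assume "u \<in> {1..Suc m}"
    then obtain k where "u = Suc k" "k \<le> m" by (cases u) auto
    with p[of k] show "?p u \<in> enat ` {2..Suc m} \<union> {\<infinity>}" and "enat u < ?p u" by simp_all
  qed (auto simp: odd_part_def)
  moreover have "card {u \<in> {1..Suc m}. ?p u = \<infinity>} = i"
  proof -
    have even: "f (2 * k) \<noteq> 2 * m + 1" if "k \<in> {1..m}" for k
      using f that by (cases rule: excedant_doublings_even) auto
    have "card {x \<in> {1..2 * m + 1}. f x = 2 * m + 1} = i"
      using f unfolding excedant_doublings_def by blast
    then show ?thesis using card_top_preimage[of m f "2 * m + 1" ?p] p even by simp
  qed
  moreover have "?g \<in> PiE {1..m} (\<lambda>a. {a..m} \<union> {})"
  proof (rule PiE_I)
    fix k assume k: "k \<in> {1..m}"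
    with f show "?g k \<in> {k..m} \<union> {}"
      by (cases rule: excedant_doublings_even) (auto simp: even_part_eq[OF k])
  qed (auto simp: even_part_def)
  moreover have "{1..m} - {r. Suc r \<in> finite_parents (Suc m) ?p} \<subseteq> ?g ` {1..m}"
  proof
    fix r assume r: "r \<in> {1..m} - {r. Suc r \<in> finite_parents (Suc m) ?p}"
    have "2 * r \<in> f ` {1..2 * m + 1}"
      using f r unfolding excedant_doublings_def by auto
    \<comment> \<open>An odd \<open>x\<close> would make \<open>Suc r\<close> a parent, against the
      choice of \<open>r\<close>; so \<open>x\<close> is even and gives a preimage under
      \<open>?g\<close>.\<close>
    then obtain x where x: "x \<in> {1..2 * m + 1}" "f x = 2 * r" by auto
    from x(1) show "r \<in> ?g ` {1..m}"
    proof (cases rule: odd_even_cases)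
      case (odd k)
      then have "?p (Suc k) = enat (Suc r)" using x r by (auto simp: odd_part_Suc)
      then have "Suc r \<in> finite_parents (Suc m) ?p"
        unfolding finite_parents_def using odd by (auto intro!: rev_image_eqI[of "Suc k"])
      with r show ?thesis by blast
    next
      case (even k)
      then have "r = ?g k" using x by (simp add: even_part_eq)
      then show ?thesis using even(1) by (rule image_eqI)
    qed
  qed
  ultimately show ?thesis unfolding split_pairs_def excedant_covers_def by blast
qed

lemma interleave_parts:
  assumes f: "f \<in> excedant_doublings m i"
  shows "interleave m (odd_part m f) (even_part m f) = f"
proof
  fix x
  show "interleave m (odd_part m f) (even_part m f) x = f x"
  proof (cases "x \<in> {1..2 * m + 1}")
    case True
    then show ?thesis
    proof (cases rule: odd_even_cases)
      case (odd k)
      from f odd(1) show ?thesis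
        by (cases rule: excedant_doublings_odd) (auto simp: odd interleave_odd odd_part_Suc)
    next
      case (even k)
      from f even(1) show ?thesis
        by (cases rule: excedant_doublings_even)
          (use even in \<open>simp add: interleave_even even_part_eq\<close>)
    qed
  next
    case False
    moreover have "f x = undefined"
      using f False unfolding excedant_doublings_def excedant_functions_def
      by (blast intro: PiE_arb)
    ultimately show ?thesis by (simp only: interleave_def restrict_apply if_False)
  qed
qed

lemma parts_interleave:
  assumes pg: "(p, g) \<in> split_pairs m i"
  shows "odd_part m (interleave m p g) = p" "even_part m (interleave m p g) = g"
proof -
  have p: "parent_function (Suc m) p" and g: "g \<in> PiE {1..m} (\<lambda>a. {a..m})"
    using pg unfolding split_pairs_def excedant_covers_def by auto
  show "odd_part m (interleave m p g) = p"
  proof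
    fix u
    show "odd_part m (interleave m p g) u = p u"
    proof (cases "u \<in> {1..Suc m}")
      case True
      then obtain k where k: "u = Suc k" "k \<le> m" by (cases u) auto
      from p k(2) show ?thesis
        by (cases rule: parent_function_cases) (auto simp: k odd_part_Suc interleave_odd)
    next
      case False
      moreover have "p u = undefined"
        using p False unfolding parent_function_def by (blast intro: PiE_arb)
      ultimately show ?thesis by (simp only: odd_part_def restrict_apply if_False)
    qed
  qed
  show "even_part m (interleave m p g) = g"
  proof
    fix k
    show "even_part m (interleave m p g) k = g k"
    proof (cases "k \<in> {1..m}")
      case True
      then show ?thesis by (simp add: even_part_eq interleave_even)
    next
      case False
      then show ?thesis using PiE_arb[OF g False] by (simp only: even_part_def restrict_apply if_False)
    qed
  qed
qed

lemma card_excedant_doublings: "card (excedant_doublings m i) = card (split_pairs m i)"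
proof -
  have "bij_betw (\<lambda>(p, g). interleave m p g) (split_pairs m i) (excedant_doublings m i)"
    by (rule bij_betw_byWitness[where f' = "\<lambda>f. (odd_part m f, even_part m f)"])
      (auto simp: parts_interleave interleave_parts interleave_in_excedant_doublings parts_in_split_pairs)
  from bij_betw_same_card[OF this] show ?thesis by simp
qed

section \<open>Comparing both counts for a fixed parent function\<close>

text \<open>Since \<open>p u > u \<ge> 1\<close>, the letter 1 is never a parent. Lowering all
  parents by one therefore keeps the counts, and the products agree after dropping the factor 1 at
  \<open>v = 0\<close>.\<close>

lemma card_permutes_eq_card_excedant_covers:
  assumes "parent_function (Suc m) p"
  shows "card {\<pi>. \<pi> permutes {1..Suc m} \<and> descent_bottoms_in (Suc m) (finite_parents (Suc m) p) \<pi>} =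
    card (excedant_covers m {} ({1..m} - {r. Suc r \<in> finite_parents (Suc m) p}))"
proof -
  let ?J = "finite_parents (Suc m) p"
  have J1: "1 \<notin> ?J"
  proof
    assume "1 \<in> ?J"
    then obtain u where u: "u \<in> {1..Suc m}" "p u = enat 1" unfolding finite_parents_def by auto
    then have "enat u < enat 1" using assms unfolding parent_function_def by metis
    then show False using u(1) by simp
  qed
  have "?J \<inter> {1..Suc v} = Suc ` ({r. Suc r \<in> ?J} \<inter> {1..v})" for v
  proof (intro equalityI subsetI)
    fix x assume x: "x \<in> ?J \<inter> {1..Suc v}"
    then have "x \<noteq> 1" using J1 by blast
    with x obtain r where "x = Suc r" "r \<noteq> 0" by (cases x) auto
    with x show "x \<in> Suc ` ({r. Suc r \<in> ?J} \<inter> {1..v})" by auto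
  qed auto
  then have shift: "card (?J \<inter> {1..Suc v}) = card ({r. Suc r \<in> ?J} \<inter> {1..v})" for v
    by (simp add: card_image)
  show ?thesis
    unfolding card_permutes_descent_bottoms_in card_excedant_covers_empty
      prod.lessThan_Suc_shift shift by simp
qed

theorem theorem7p1:
  fixes n i :: nat
  assumes "i \<in> {1..n}"
  shows "(\<Sum>j=0..n. num_alt_acyclic n i j) =
    card {f \<in> excedant_functions (2 * n - 1).
            (\<forall>k\<in>{1..n - 1}. f (2 * k) \<le> 2 * n - 2) \<and>
            f ` {1..2 * n - 1} = (\<lambda>k. 2 * k) ` {1..n - 1} \<union> {2 * n - 1} \<and>
            card {x \<in> {1..2 * n - 1}. f x = 2 * n - 1} = i}"
proof -
  obtain m where n: "n = Suc m" using assms by (cases n) auto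
  let ?P = "{p. parent_function (Suc m) p \<and> card {u \<in> {1..Suc m}. p u = \<infinity>} = i}"
  have finP: "finite ?P" using finite_parent_functions[of "Suc m"] by (rule finite_subset[rotated]) auto
  \<comment> \<open>\<open>representations\<close> and \<open>split_pairs\<close> are fibred over
    the same parent functions, so their cardinalities are compared fibre by fibre.\<close>
  have "card (representations (Suc m) i) = (\<Sum>p\<in>?P.
      card {\<pi>. \<pi> permutes {1..Suc m} \<and> descent_bottoms_in (Suc m) (finite_parents (Suc m) p) \<pi>})"
    unfolding representations_def
    by (intro card_SigmaI finP ballI finite_subset[OF _ finite_permutations[of "{1..Suc m}"]]) auto
  also have "\<dots> = (\<Sum>p\<in>?P.
      card (excedant_covers m {} ({1..m} - {r. Suc r \<in> finite_parents (Suc m) p})))"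
    by (rule sum.cong[OF refl], rule card_permutes_eq_card_excedant_covers) blast
  also have "\<dots> = card (split_pairs m i)"
    unfolding split_pairs_def
    by (rule card_SigmaI[symmetric, OF finP]) (simp add: finite_excedant_covers)
  also have "\<dots> = card (excedant_doublings m i)" by (rule card_excedant_doublings[symmetric])
  finally have "(\<Sum>j=0..n. num_alt_acyclic n i j) = card (excedant_doublings m i)"
    unfolding n using sum_num_alt_acyclic[of "Suc m" i] by simp
  moreover have "2 * Suc m - 1 = 2 * m + 1" "2 * Suc m - 2 = 2 * m" "Suc m - 1 = m" by simp_all
  ultimately show ?thesis unfolding n excedant_doublings_def by simp
qed

end
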